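(* Let $K$ be a field of characteristic zero, $R=K[x,y,z]$ with the standard grading, and let $a,b,c,\beta,\gamma$ be integers with $a\geq c\geq 2$, $1\leq \beta\leq b-1$ and $\max\{1,b-a+1\}\leq \gamma\leq \min\{b-1,c-1\}$. Consider the ideal $$I=(x^a,\ y^b-x^{b-\gamma}z^\gamma,\ z^c,\ x^{a-b+\gamma}y^{b-\beta},\ y^{b-\beta}z^{c-\gamma})\subset R.$$ If one of $a,b,c$ is equal to four, then $R/I$ has the weak Lefschetz property.
   Context: A graded Artinian $K$-algebra $A=\bigoplus_i [A]_i$ has the weak Lefschetz property (WLP) if there exists a linear form $L\in[A]_1$ such that the multiplication map $\times L:[A]_i\to[A]_{i+1}$ has maximal rank (i.e. is injective or surjective) for every $i$. *)

theory Defs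
  imports "HOL-Library.Poly_Mapping" "HOL-Library.Product_Plus"
begin

text \<open>The polynomial ring K[x,y,z]: finitely supported functions from exponent
  vectors (i,j,k) (the monomial x^i y^j z^k) to coefficients in K.  Multiplication
  is the convolution product provided by Poly_Mapping, using componentwise addition
  of exponent vectors.\<close>

type_synonym 'a poly3 = "(nat \<times> nat \<times> nat) \<Rightarrow>\<^sub>0 'a"

definition mon :: "nat \<Rightarrow> nat \<Rightarrow> nat \<Rightarrow> 'a::comm_ring_1 poly3" where
  "mon i j k = Poly_Mapping.single (i, j, k) 1"

definition X :: "'a::comm_ring_1 poly3" where "X = mon 1 0 0"
definition Y :: "'a::comm_ring_1 poly3" where "Y = mon 0 1 0"
definition Z :: "'a::comm_ring_1 poly3" where "Z = mon 0 0 1"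

definition mdeg :: "nat \<times> nat \<times> nat \<Rightarrow> nat" where
  "mdeg m = fst m + fst (snd m) + snd (snd m)"

definition homog :: "nat \<Rightarrow> 'a::comm_ring_1 poly3 \<Rightarrow> bool" where
  "homog d f \<longleftrightarrow> (\<forall>m \<in> Poly_Mapping.keys f. mdeg m = d)"

definition ideal_gen :: "'a::comm_ring_1 poly3 set \<Rightarrow> 'a poly3 set" where
  "ideal_gen G = {f. \<exists>c. f = (\<Sum>g\<in>G. c g * g)}"

text \<open>For a homogeneous ideal I, multiplication by L on A = R/I in degree i,
  [A]_i \<rightarrow> [A]_{i+1}, is injective resp. surjective (written out on representatives).\<close>
definition mult_injective :: "'a::comm_ring_1 poly3 set \<Rightarrow> 'a poly3 \<Rightarrow> nat \<Rightarrow> bool" where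
  "mult_injective I L i \<longleftrightarrow> (\<forall>f. homog i f \<and> L * f \<in> I \<longrightarrow> f \<in> I)"

definition mult_surjective :: "'a::comm_ring_1 poly3 set \<Rightarrow> 'a poly3 \<Rightarrow> nat \<Rightarrow> bool" where
  "mult_surjective I L i \<longleftrightarrow>
     (\<forall>g. homog (Suc i) g \<longrightarrow> (\<exists>f. homog i f \<and> g - L * f \<in> I))"

definition has_WLP :: "'a::comm_ring_1 poly3 set \<Rightarrow> bool" where
  "has_WLP I \<longleftrightarrow> (\<exists>L. homog 1 L \<and>
     (\<forall>i. mult_injective I L i \<or> mult_surjective I L i))"

end

theory Submission
  imports Defs "HOL-Computational_Algebra.Polynomial"
begin

text \<open>
  Write \<open>n = b - \<beta>\<close>, \<open>p = a - b + \<gamma>\<close>, \<open>q = c - \<gamma>\<close>, \<open>l = x + z\<close> and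
  take \<open>L = l - t y\<close>. The quotient \<open>R/I\<close> is Gorenstein with socle generator
  \<open>x\<^bsup>a-1\<^esup> y\<^bsup>n-1\<^esup> z\<^bsup>c-1\<^esup>\<close> in degree \<open>e = a + n + c - 3\<close>, so by duality the weak Lefschetz
  property follows once \<open>R/(I, L)\<close> vanishes in degree \<open>d = \<lfloor>e/2\<rfloor> + 1\<close>.

  Modulo \<open>L\<close> the generators become \<open>x\<^bsup>a\<^esup>\<close>, \<open>z\<^bsup>c\<^esup>\<close>, \<open>x\<^bsup>p\<^esup> l\<^bsup>n\<^esup>\<close>, \<open>z\<^bsup>q\<^esup> l\<^bsup>n\<^esup>\<close> and
  \<open>l\<^bsup>b\<^esup> - t\<^bsup>b\<^esup> x\<^bsup>b-\<gamma>\<^esup> z\<^bsup>\<gamma>\<^esup>\<close>, up to powers of \<open>t\<close>. In characteristic zero every binary form of degree \<open>D\<close>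
  lies in \<open>(x\<^bsup>A\<^esup>, z\<^bsup>C\<^esup>, l\<^bsup>k\<^esup>)\<close> as soon as \<open>A + C + k \<le> 2D + 2\<close>. Applying this to
  \<open>(a, c, n)\<close> in degree \<open>d\<close> and then to \<open>(p, q, b - n)\<close> in degree \<open>d - n\<close> shows that for
  \<open>t = 0\<close> the displayed forms generate everything in degree \<open>d\<close>. This is an open condition
  on \<open>t\<close>, so it also holds for some \<open>t \<noteq> 0\<close>, where \<open>y = l/t\<close> modulo \<open>L\<close>.
\<close>

section \<open>Binary forms in three powers of linear forms\<close>

text \<open>\<open>fits D a f\<close> stands for deg \<open>f \<le> D - a\<close>, with \<open>f = 0\<close> when \<open>D < a\<close>.\<close>

definition fits :: "nat \<Rightarrow> nat \<Rightarrow> 'a::zero poly \<Rightarrow> bool" where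
  "fits D a f \<longleftrightarrow> f = 0 \<or> a + degree f \<le> D"

lemma fits_add: "fits D a f \<Longrightarrow> fits D a g \<Longrightarrow> fits D a (f + g)"
  using degree_add_le_max[of f g] by (auto simp: fits_def)

lemma fits_smult:
  fixes f :: "'a::field poly"
  shows "fits D a f \<Longrightarrow> fits D a (smult w f)"
  by (auto simp: fits_def)

lemma fits_linear_mult:
  fixes r f :: "'a::field poly"
  assumes "fits D a f" "degree r \<le> 1"
  shows "fits (Suc D) a (r * f)"
  using assms degree_mult_le[of r f] by (auto simp: fits_def)

lemma fits_Suc: "fits D a f \<Longrightarrow> fits (Suc D) (Suc a) f"
  by (auto simp: fits_def)

text \<open>Dividing \<open>f\<close> by the linear form leaves a constant, integrated directly, and
  a multiple of the form, handled by induction with exponent \<open>Suc a\<close>; so the primitive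
  keeps the factor \<open>[:u, v:] ^ Suc a\<close>. Characteristic zero makes \<open>Suc a\<close>
  invertible.\<close>

lemma antiderivative_linear_power:
  fixes u v :: "'a::field_char_0" and f :: "'a poly"
  assumes "v \<noteq> 0"
  shows "\<exists>F. pderiv ([:u, v:] ^ Suc a * F) = [:u, v:] ^ a * f \<and> degree F \<le> degree f \<and> (f = 0 \<longrightarrow> F = 0)"
proof (induction "degree f" arbitrary: f a rule: less_induct)
  case less
  let ?r = "[:u, v:]"
  have dr: "pderiv ?r = [:v:]" by (simp add: pderiv_pCons)
  have const: "pderiv (?r ^ Suc a * [:w / (of_nat (Suc a) * v):]) = ?r ^ a * [:w:]" for w
  proof -
    have "pderiv (?r ^ Suc a * [:w / (of_nat (Suc a) * v):]) =
        [:w / (of_nat (Suc a) * v):] * (smult (of_nat (Suc a)) (?r ^ a) * [:v:])"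
      by (simp only: pderiv_mult pderiv_power_Suc dr) (simp add: pderiv_pCons del: of_nat_Suc)
    also have "\<dots> = ?r ^ a * smult (w / (of_nat (Suc a) * v) * of_nat (Suc a) * v) 1"
      by (simp add: mult.commute mult.left_commute del: of_nat_Suc)
    also have "w / (of_nat (Suc a) * v) * of_nat (Suc a) * v = w"
      using assms by (simp del: of_nat_Suc)
    finally show ?thesis by simp
  qed
  show ?case
  proof (cases "degree f = 0")
    case True
    then obtain w where w: "f = [:w:]" by (metis degree_eq_zeroE)
    show ?thesis
      using const[of w] w by (intro exI[of _ "[:w / (of_nat (Suc a) * v):]"]) (simp del: of_nat_Suc)
  next
    case False
    define w where "w = poly f (- u / v)"
    have "poly (f - [:w:]) (- u / v) = 0" by (simp add: w_def)
    then obtain h0 where h0: "f - [:w:] = [:- (- u / v), 1:] * h0"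
      using poly_eq_0_iff_dvd dvdE by metis
    define h where "h = smult (1 / v) h0"
    have r: "?r = smult v [:- (- u / v), 1:]" using assms by simp
    have fh: "f = [:w:] + ?r * h"
    proof -
      have "?r * h = [:- (- u / v), 1:] * h0"
        unfolding r h_def using assms by (simp only: mult_smult_left mult_smult_right smult_smult) simp
      then show ?thesis using h0 by (metis add.commute diff_add_cancel)
    qed
    have "h \<noteq> 0" using fh False by auto
    then have "degree (?r * h) = Suc (degree h)"
      using assms by (subst degree_mult_eq) auto
    then have deg: "degree f = Suc (degree h)"
      using fh degree_add_eq_right[of "[:w:]" "?r * h"] by simp
    then obtain H where H: "pderiv (?r ^ Suc (Suc a) * H) = ?r ^ Suc a * h" "degree H \<le> degree h"
      using less[of h "Suc a"] by auto
    let ?F = "[:w / (of_nat (Suc a) * v):] + ?r * H"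
    have "?r ^ Suc a * ?F = ?r ^ Suc a * [:w / (of_nat (Suc a) * v):] + ?r ^ Suc (Suc a) * H"
      by (simp only: power_Suc2 distrib_left mult.assoc)
    then have "pderiv (?r ^ Suc a * ?F) = ?r ^ a * [:w:] + ?r ^ Suc a * h"
      using H const[of w] by (simp only: pderiv_add)
    also have "\<dots> = ?r ^ a * f"
      unfolding fh by (simp only: power_Suc2 distrib_left mult.assoc)
    finally have "pderiv (?r ^ Suc a * ?F) = ?r ^ a * f" .
    moreover have "degree ?F \<le> degree f"
    proof (rule degree_add_le)
      show "degree [:w / (of_nat (Suc a) * v):] \<le> degree f" by simp
      have "degree ?r \<le> 1" by simp
      then show "degree (?r * H) \<le> degree f"
        using degree_mult_le[of ?r H] H(2) deg by linarith
    qed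
    ultimately show ?thesis using False by (intro exI[of _ ?F]) auto
  qed
qed

text \<open>Since x + z = 1, expanding (x + z)^D gives terms divisible by x^A or z^C. The induction
  multiplies by \<open>?x + ?z\<close> once, using smaller \<open>A\<close> for one summand and
  smaller \<open>C\<close> for the other.\<close>

lemma one_in_two_powers:
  assumes "A + C \<le> Suc D"
  shows "\<exists>\<alpha> \<beta>. (1 :: 'a::field_char_0 poly) = [:0, 1:] ^ A * \<alpha> + [:1, -1:] ^ C * \<beta> \<and> fits D A \<alpha> \<and> fits D C \<beta>"
  using assms
proof (induction D arbitrary: A C)
  case 0
  then consider "A = 0" | "C = 0" by linarith
  then show ?case
    by cases (rule exI[of _ 1] exI[of _ 0], rule exI[of _ 0] exI[of _ 1], simp add: fits_def)+
next
  case (Suc D)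
  show ?case
  proof (cases "A = 0 \<or> C = 0")
    case True
    then show ?thesis
    proof
      assume "A = 0" then show ?thesis by (intro exI[of _ 1] exI[of _ 0]) (simp add: fits_def)
    next
      assume "C = 0" then show ?thesis by (intro exI[of _ 0] exI[of _ 1]) (simp add: fits_def)
    qed
  next
    case False
    then obtain A' C' where AC: "A = Suc A'" "C = Suc C'" by (metis not0_implies_Suc)
    let ?x = "[:0, 1:] :: 'a poly" and ?z = "[:1, -1:] :: 'a poly"
    obtain \<alpha>1 \<beta>1 where 1: "1 = ?x ^ A' * \<alpha>1 + ?z ^ C * \<beta>1" "fits D A' \<alpha>1" "fits D C \<beta>1"
      using Suc.IH[of A' C] Suc.prems AC by auto
    obtain \<alpha>2 \<beta>2 where 2: "1 = ?x ^ A * \<alpha>2 + ?z ^ C' * \<beta>2" "fits D A \<alpha>2" "fits D C' \<beta>2"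
      using Suc.IH[of A C'] Suc.prems AC by auto
    have "?x + ?z = 1" by simp
    then have "1 = ?x * 1 + ?z * 1" by (simp only: mult_1_right)
    also have "\<dots> = ?x * (?x ^ A' * \<alpha>1 + ?z ^ C * \<beta>1) + ?z * (?x ^ A * \<alpha>2 + ?z ^ C' * \<beta>2)"
      using 1(1) 2(1) by metis
    also have "\<dots> = ?x ^ A * (\<alpha>1 + ?z * \<alpha>2) + ?z ^ C * (?x * \<beta>1 + \<beta>2)"
      unfolding AC power_Suc by algebra
    finally have "1 = ?x ^ A * (\<alpha>1 + ?z * \<alpha>2) + ?z ^ C * (?x * \<beta>1 + \<beta>2)" .
    moreover have "fits (Suc D) A (\<alpha>1 + ?z * \<alpha>2)"
      using 1(2) 2(2) unfolding AC by (intro fits_add fits_Suc fits_linear_mult) simp_all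
    moreover have "fits (Suc D) C (?x * \<beta>1 + \<beta>2)"
      using 1(3) 2(3) unfolding AC by (intro fits_add fits_Suc fits_linear_mult) simp_all
    ultimately show ?thesis by blast
  qed
qed

text \<open>With \<open>l = 1\<close> and \<open>z = 1 - x\<close>, this says that forms of degree \<open>D\<close> lie in
  \<open>(x\<^bsup>A\<^esup>, z\<^bsup>C\<^esup>, l\<^bsup>k\<^esup>)\<close>. The induction differentiates in \<open>x\<close> with \<open>l\<close> fixed, which lowers \<open>A\<close>, \<open>C\<close>, \<open>D\<close>
  by one each, and integrates back; only the constant of integration needs care.\<close>

lemma three_powers_decomposition:
  fixes f :: "'a::field_char_0 poly"
  assumes "A + C + k \<le> 2 * D + 2" "degree f \<le> D"
  shows "\<exists>\<alpha> \<beta> g. f = [:0, 1:] ^ A * \<alpha> + [:1, -1:] ^ C * \<beta> + g \<and> fits D A \<alpha> \<and> fits D C \<beta> \<and> fits D k g"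
  using assms
proof (induction A arbitrary: C D f)
  case 0
  then show ?case by (intro exI[of _ f] exI[of _ 0]) (simp add: fits_def)
next
  case (Suc A)
  let ?x = "[:0, 1:] :: 'a poly" and ?z = "[:1, -1:] :: 'a poly"
  show ?case
  proof (cases C)
    case 0
    then show ?thesis using Suc.prems
      by (intro exI[of _ 0] exI[of _ f] exI[of _ 0]) (simp add: fits_def)
  next
    case C: (Suc C')
    show ?thesis
    proof (cases D)
      \<comment> \<open>Both \<open>Suc A\<close> and \<open>C\<close> are positive, so the
        hypothesis forces \<open>k = 0\<close> and the constant \<open>f\<close> is the last
        summand.\<close>
      case 0
      then show ?thesis using Suc.prems C
        by (intro exI[of _ 0] exI[of _ 0] exI[of _ f]) (simp add: fits_def)
    next
      case D: (Suc D')
      have "degree (pderiv f) \<le> D'" using Suc.prems D by (simp add: degree_pderiv)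
      then obtain \<alpha> \<beta> g where dec: "pderiv f = ?x ^ A * \<alpha> + ?z ^ C' * \<beta> + g"
          "fits D' A \<alpha>" "fits D' C' \<beta>" "fits D' k g"
        using Suc.IH[of C' D' "pderiv f"] Suc.prems C D by auto
      obtain \<alpha>' where \<alpha>': "pderiv (?x ^ Suc A * \<alpha>') = ?x ^ A * \<alpha>" "degree \<alpha>' \<le> degree \<alpha>" "\<alpha> = 0 \<longrightarrow> \<alpha>' = 0"
        using antiderivative_linear_power[of 1 0 A \<alpha>] by auto
      obtain \<beta>' where \<beta>': "pderiv (?z ^ Suc C' * \<beta>') = ?z ^ C' * \<beta>" "degree \<beta>' \<le> degree \<beta>" "\<beta> = 0 \<longrightarrow> \<beta>' = 0"
        using antiderivative_linear_power[of "-1" 1 C' \<beta>] by auto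
      \<comment> \<open>The exponent 0 instance merely yields some primitive of \<open>g\<close>;
        its degree grows by at most one, as does \<open>D'\<close>.\<close>
      obtain G where G: "pderiv (?x * G) = g" "degree G \<le> degree g" "g = 0 \<longrightarrow> G = 0"
        using antiderivative_linear_power[of 1 0 0 g] by auto
      define F where "F = ?x ^ Suc A * \<alpha>' + ?z ^ C * \<beta>' + ?x * G"
      have "pderiv F = pderiv f"
        unfolding F_def C pderiv_add \<alpha>'(1) \<beta>'(1) G(1) dec(1) ..
      then have "pderiv (f - F) = 0" by (simp add: pderiv_diff)
      then obtain w where w: "f - F = [:w:]" using pderiv_iszero by blast
      have fits: "fits D (Suc A) \<alpha>'" "fits D C \<beta>'" "fits D k (?x * G)"
        using \<alpha>' \<beta>' G dec C D fits_linear_mult[of D' k G ?x] by (auto simp: fits_def)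
      show ?thesis
      \<comment> \<open>The constant \<open>w\<close> stands for w l^D. It is a multiple of l^k if k
        \<le> D; otherwise the hypothesis leaves Suc A + C \<le> D + 1, and l^D lies in the ideal of
        the other two powers.\<close>
      proof (cases "k \<le> D")
        case True
        then have "fits D k (?x * G + [:w:])" by (intro fits_add fits) (simp add: fits_def)
        moreover have "f = ?x ^ Suc A * \<alpha>' + ?z ^ C * \<beta>' + (?x * G + [:w:])"
          using w F_def by (metis add.assoc diff_add_cancel add.commute)
        ultimately show ?thesis using fits by blast
      next
        case False
        then obtain \<alpha>1 \<beta>1 where 1: "1 = ?x ^ Suc A * \<alpha>1 + ?z ^ C * \<beta>1" "fits D (Suc A) \<alpha>1" "fits D C \<beta>1"
          using one_in_two_powers[of "Suc A" C D] Suc.prems by auto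
        have "[:w:] = [:w:] * 1" by simp
        also have "\<dots> = [:w:] * (?x ^ Suc A * \<alpha>1 + ?z ^ C * \<beta>1)"
          using 1(1) by metis
        finally have w1: "[:w:] = ?x ^ Suc A * smult w \<alpha>1 + ?z ^ C * smult w \<beta>1" by (simp add: smult_add_right)
        have "f = F + [:w:]" using w by (metis diff_add_cancel add.commute)
        also have "\<dots> = ?x ^ Suc A * (\<alpha>' + smult w \<alpha>1) + ?z ^ C * (\<beta>' + smult w \<beta>1) + ?x * G"
          unfolding w1 F_def distrib_left by (simp only: ac_simps)
        finally have "f = ?x ^ Suc A * (\<alpha>' + smult w \<alpha>1) + ?z ^ C * (\<beta>' + smult w \<beta>1) + ?x * G" .
        moreover have "fits D (Suc A) (\<alpha>' + smult w \<alpha>1)" "fits D C (\<beta>' + smult w \<beta>1)"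
          using fits 1(2,3) by (intro fits_add fits_smult; simp)+
        ultimately show ?thesis using fits(3) by blast
      qed
    qed
  qed
qed

section \<open>Ideals and genericity\<close>

text \<open>A bare predicate, so that congruences can be stated for every ideal \<open>W\<close>
  containing given elements, without forming quotient rings.\<close>

definition is_ideal :: "'a::comm_ring_1 poly3 set \<Rightarrow> bool" where
  "is_ideal W \<longleftrightarrow> 0 \<in> W \<and> (\<forall>f\<in>W. \<forall>g\<in>W. f + g \<in> W) \<and> (\<forall>f\<in>W. \<forall>r. r * f \<in> W)"

lemma is_ideal_add: "is_ideal W \<Longrightarrow> f \<in> W \<Longrightarrow> g \<in> W \<Longrightarrow> f + g \<in> W"
  and is_ideal_mult: "is_ideal W \<Longrightarrow> f \<in> W \<Longrightarrow> r * f \<in> W"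
  and is_ideal_zero: "is_ideal W \<Longrightarrow> 0 \<in> W"
  by (auto simp: is_ideal_def)

lemma is_ideal_mult_right: "is_ideal W \<Longrightarrow> f \<in> W \<Longrightarrow> f * r \<in> W"
  using is_ideal_mult[of W f r] by (simp add: mult.commute)

lemma is_ideal_diff:
  assumes "is_ideal W" "f \<in> W" "g \<in> W"
  shows "f - g \<in> W"
  using is_ideal_add[OF assms(1,2) is_ideal_mult[OF assms(1,3), of "- 1"]] by simp

lemma is_ideal_sum: "is_ideal W \<Longrightarrow> (\<And>i. i \<in> S \<Longrightarrow> f i \<in> W) \<Longrightarrow> sum f S \<in> W"
  by (induction S rule: infinite_finite_induct) (auto simp: is_ideal_zero intro: is_ideal_add)

lemma is_ideal_diff_iff:
  assumes "is_ideal W" "f - g \<in> W"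
  shows "f \<in> W \<longleftrightarrow> g \<in> W"
proof
  assume "f \<in> W"
  then show "g \<in> W" using is_ideal_diff[OF assms(1) _ assms(2), of f] by simp
next
  assume "g \<in> W"
  then show "f \<in> W" using is_ideal_add[OF assms, of g] by simp
qed

lemma is_ideal_power_diff:
  assumes "is_ideal W" "f - g \<in> W"
  shows "f ^ n - g ^ n \<in> W"
proof (induction n)
  case 0
  then show ?case using assms by (simp add: is_ideal_zero)
next
  case (Suc n)
  have "f ^ Suc n - g ^ Suc n = f * (f ^ n - g ^ n) + g ^ n * (f - g)"
    by (simp add: algebra_simps)
  then show ?case
    using Suc assms by (auto intro!: is_ideal_add is_ideal_mult)
qed

lemma ideal_gen_is_ideal: "is_ideal (ideal_gen G)"
proof -
  have "0 \<in> ideal_gen G" unfolding ideal_gen_def by (auto intro: exI[of _ "\<lambda>_. 0"])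
  moreover have "f + g \<in> ideal_gen G" if fg: "f \<in> ideal_gen G" "g \<in> ideal_gen G" for f g
  proof -
    obtain u v where "f = (\<Sum>h\<in>G. u h * h)" "g = (\<Sum>h\<in>G. v h * h)"
      using fg unfolding ideal_gen_def by auto
    then have "f + g = (\<Sum>h\<in>G. (u h + v h) * h)" by (simp add: sum.distrib distrib_right)
    then show ?thesis unfolding ideal_gen_def by (auto intro: exI[of _ "\<lambda>h. u h + v h"])
  qed
  moreover have "r * f \<in> ideal_gen G" if f: "f \<in> ideal_gen G" for f r
  proof -
    obtain u where "f = (\<Sum>h\<in>G. u h * h)" using f unfolding ideal_gen_def by auto
    then have "r * f = (\<Sum>h\<in>G. (r * u h) * h)" by (simp add: sum_distrib_left mult.assoc)
    then show ?thesis unfolding ideal_gen_def by (auto intro: exI[of _ "\<lambda>h. r * u h"])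
  qed
  ultimately show ?thesis by (auto simp: is_ideal_def)
qed

lemma generator_in_ideal_gen:
  assumes "finite G" "g \<in> G"
  shows "g \<in> ideal_gen G"
proof -
  have "(\<Sum>h\<in>G. (if h = g then 1 else 0) * h) = (\<Sum>h\<in>G. if h = g then g else 0)"
    by (intro sum.cong) auto
  also have "\<dots> = g" using assms by simp
  finally show ?thesis unfolding ideal_gen_def by (auto intro!: exI[of _ "\<lambda>h. if h = g then 1 else 0"])
qed

lemma is_ideal_plus_principal:
  assumes "is_ideal W"
  shows "is_ideal {L * f + h |f h. h \<in> W}"
proof -
  have "\<exists>f h. 0 = L * f + h \<and> h \<in> W"
    by (rule exI[of _ 0], rule exI[of _ 0]) (simp add: is_ideal_zero assms)
  moreover have "\<exists>f'' h''. (L * f + h) + (L * f' + h') = L * f'' + h'' \<and> h'' \<in> W"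
    if "h \<in> W" "h' \<in> W" for f h f' h'
    using that is_ideal_add[OF assms, of h h'] by (metis (no_types, opaque_lifting) add.assoc add.left_commute distrib_left)
  moreover have "\<exists>f' h'. r * (L * f + h) = L * f' + h' \<and> h' \<in> W" if "h \<in> W" for f h r
    using that is_ideal_mult[OF assms, of h r] by (metis distrib_left mult.left_commute)
  ultimately show ?thesis unfolding is_ideal_def by blast
qed

section \<open>Scalars and elimination over a parameter\<close>

definition scal :: "'a::comm_ring_1 \<Rightarrow> 'a poly3" where
  "scal c = Poly_Mapping.single 0 c"

lemma scal_0 [simp]: "scal 0 = 0" and scal_1 [simp]: "scal 1 = 1"
  and scal_add: "scal (u + v) = scal u + scal v"
  and scal_diff: "scal (u - v) = scal u - scal v"
  and scal_mult: "scal (u * v) = scal u * scal v"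
  by (simp_all add: scal_def single_add single_diff mult_single)

lemma scal_minus: "scal (- u) = - scal u"
  by (simp add: scal_def single_uminus)

lemma scal_power: "scal (u ^ n) = scal u ^ n"
  by (induction n) (simp_all add: scal_mult)

lemma is_ideal_scal_cancel:
  fixes u :: "'a::field"
  assumes "is_ideal W" "u \<noteq> 0" "scal u * f \<in> W"
  shows "f \<in> W"
proof -
  have "scal (inverse u) * (scal u * f) = f"
    using assms(2) by (simp add: mult.assoc[symmetric] scal_mult[symmetric])
  then show ?thesis using is_ideal_mult[OF assms(1,3), of "scal (inverse u)"] by simp
qed

text \<open>Gaussian elimination on \<open>e = t M e\<close> modulo \<open>W\<close>: the pivots are polynomials in \<open>t\<close> with value
  \<open>1\<close> at the origin, and \<open>P\<close> is their product.\<close>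

lemma generic_elimination:
  fixes M :: "nat \<Rightarrow> nat \<Rightarrow> 'a::field poly"
  shows "\<exists>P. poly P 0 = 1 \<and> (\<forall>t W e. poly P t \<noteq> 0 \<longrightarrow> is_ideal W \<longrightarrow>
     (\<forall>i<N. e i - scal t * (\<Sum>j<N. scal (poly (M i j) t) * e j) \<in> W) \<longrightarrow> (\<forall>i<N. e i \<in> W))"
proof (induction N arbitrary: M)
  case 0
  then show ?case by (intro exI[of _ 1]) auto
next
  case (Suc N)
  \<comment> \<open>The pivot of the last equation.\<close>
  define U where "U = 1 - [:0, 1:] * M N N"
  \<comment> \<open>Row \<open>i\<close> times the pivot plus t \<open>M i N\<close> times the last
    row eliminates \<open>e N\<close>. The diagonal term \<open>M N N\<close> arises from writing
    \<open>U\<close> times \<open>e i\<close> as \<open>e i\<close> minus t \<open>M N N\<close>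
    \<open>e i\<close>.\<close>
  define M' where "M' i j = U * M i j + [:0, 1:] * M i N * M N j + (if i = j then M N N else 0)" for i j
  obtain P where P0: "poly P 0 = 1" and P: "\<forall>t W e. poly P t \<noteq> 0 \<longrightarrow> is_ideal W \<longrightarrow>
     (\<forall>i<N. e i - scal t * (\<Sum>j<N. scal (poly (M' i j) t) * e j) \<in> W) \<longrightarrow> (\<forall>i<N. e i \<in> W)"
    using Suc.IH[of M'] by (elim exE conjE)
  have "e i \<in> W" if t: "poly (U * P) t \<noteq> 0" and W: "is_ideal W"
      and e: "\<And>i. i < Suc N \<Longrightarrow> e i - scal t * (\<Sum>j<Suc N. scal (poly (M i j) t) * e j) \<in> W"
      and i: "i < Suc N" for t W e i
  proof -
    define m where "m i j = scal (poly (M i j) t)" for i j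
    define S where "S i = (\<Sum>j<N. m i j * e j)" for i
    define u where "u = scal (poly U t)"
    have u: "u = 1 - scal t * m N N" by (simp add: u_def U_def m_def scal_diff scal_mult)
    have eqN: "u * e N - scal t * S N \<in> W"
      using e[of N] by (simp add: u S_def m_def algebra_simps)
    have "e i - scal t * (\<Sum>j<N. scal (poly (M' i j) t) * e j) \<in> W" if i: "i < N" for i
    proof -
      have eqi: "e i - scal t * (S i + m i N * e N) \<in> W"
        using e[of i] i by (simp add: S_def m_def)
      have "(\<Sum>j<N. scal (poly (M' i j) t) * e j)
          = (\<Sum>j<N. u * (m i j * e j) + scal t * m i N * (m N j * e j) + (if i = j then m N N * e j else 0))"
        by (intro sum.cong) (auto simp: M'_def u_def m_def scal_add scal_mult algebra_simps)
      also have "\<dots> = u * S i + scal t * m i N * S N + m N N * e i"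
        using i by (simp add: sum.distrib S_def sum_distrib_left sum.delta')
      finally have sum_eq: "(\<Sum>j<N. scal (poly (M' i j) t) * e j) = u * S i + scal t * m i N * S N + m N N * e i" .
      have "e i - scal t * (\<Sum>j<N. scal (poly (M' i j) t) * e j)
          = u * (e i - scal t * (S i + m i N * e N)) + (scal t * m i N) * (u * e N - scal t * S N)"
        unfolding sum_eq by (simp add: u algebra_simps)
      then show ?thesis
        using eqi eqN W by (simp add: is_ideal_add is_ideal_mult)
    qed
    moreover have "poly P t \<noteq> 0" using t by simp
    ultimately have lower: "e i \<in> W" if "i < N" for i
      using P W that by blast
    show ?thesis
    proof (cases "i < N")
      case False
      then have "i = N" using i by simp
      have "scal t * S N \<in> W"
        unfolding S_def using lower W by (intro is_ideal_mult is_ideal_sum) auto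
      then have "u * e N \<in> W" using eqN W is_ideal_diff_iff by blast
      then show ?thesis
        unfolding u_def \<open>i = N\<close> using t W is_ideal_scal_cancel[of W "poly U t" "e N"] by simp
    qed (rule lower)
  qed
  moreover have "poly (U * P) 0 = 1" using P0 by (simp add: U_def)
  ultimately show ?case by (intro exI[of _ "U * P"]) blast
qed

text \<open>The homogenizing variable is \<open>x + z\<close>, so that \<open>1 - x\<close> becomes \<open>z\<close>.\<close>

definition homogenize :: "nat \<Rightarrow> 'a::comm_ring_1 poly \<Rightarrow> 'a poly3" where
  "homogenize D f = (\<Sum>i\<le>D. scal (coeff f i) * (X ^ i * (X + Z) ^ (D - i)))"

lemma homogenize_add: "homogenize D (f + g) = homogenize D f + homogenize D g"
  by (simp add: homogenize_def scal_add distrib_right sum.distrib)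

lemma homogenize_0 [simp]: "homogenize D 0 = 0"
  by (simp add: homogenize_def)

lemma homogenize_1: "homogenize 0 1 = 1"
  by (simp add: homogenize_def)

lemma homogenize_X: "homogenize (Suc D) ([:0, 1:] * f) = X * homogenize D f"
proof -
  have "homogenize (Suc D) ([:0, 1:] * f) =
      (\<Sum>i\<le>D. scal (coeff f i) * (X ^ Suc i * (X + Z) ^ (D - i)))"
    unfolding homogenize_def by (subst sum.atMost_Suc_shift) simp
  then show ?thesis by (simp add: homogenize_def sum_distrib_left ac_simps)
qed

text \<open>\<open>homogenize D\<close> discards coefficients beyond index \<open>D\<close>; the
  degree bound ensures that none appears when \<open>D\<close> is raised.\<close>

lemma homogenize_Suc:
  assumes "f = 0 \<or> degree f \<le> D"
  shows "homogenize (Suc D) f = (X + Z) * homogenize D f"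
proof -
  have "coeff f (Suc D) = 0" using assms by (auto intro: coeff_eq_0)
  then have "homogenize (Suc D) f = (\<Sum>i\<le>D. scal (coeff f i) * (X ^ i * (X + Z) ^ Suc (D - i)))"
    by (simp add: homogenize_def Suc_diff_le)
  then show ?thesis by (simp add: homogenize_def sum_distrib_left ac_simps)
qed

lemma homogenize_smult: "homogenize D (smult u f) = scal u * homogenize D f"
  by (simp add: homogenize_def sum_distrib_left scal_mult ac_simps)

lemma homogenize_Z:
  assumes "f = 0 \<or> degree f \<le> D"
  shows "homogenize (Suc D) ([:1, -1:] * f) = Z * homogenize D f"
proof -
  have "[:1, -1:] * f = f + smult (- 1) ([:0, 1:] * f)" by simp
  then have "homogenize (Suc D) ([:1, -1:] * f)
      = homogenize (Suc D) f + scal (- 1) * homogenize (Suc D) ([:0, 1:] * f)"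
    by (simp only: homogenize_add homogenize_smult)
  then show ?thesis
    using homogenize_Suc[OF assms] homogenize_X[of D f] by (simp add: scal_minus algebra_simps)
qed

lemma degree_linear_power_mult:
  fixes f r :: "'a::field poly"
  assumes "degree r \<le> 1"
  shows "degree (r ^ k * f) \<le> k + degree f"
  using assms degree_mult_le[of "r ^ k" f] degree_power_le[of r k]
  by (metis (no_types, opaque_lifting) add_le_mono1 le_trans mult_le_mono1 nat_mult_1)

lemma homogenize_X_power: "homogenize (k + D) ([:0, 1:] ^ k * f) = X ^ k * homogenize D f"
  by (induction k) (simp_all only: power_0 power_Suc mult_1_left add_0 add_Suc mult.assoc homogenize_X)

lemma homogenize_Z_power:
  fixes f :: "'a::field poly"
  assumes "degree f \<le> D"
  shows "homogenize (k + D) ([:1, -1:] ^ k * f) = Z ^ k * homogenize D f"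
proof (induction k)
  case (Suc k)
  have "degree ([:1, -1:] ^ k * f) \<le> k + D"
    using degree_linear_power_mult[of "[:1, -1:]" k f] assms by simp
  then show ?case
    using homogenize_Z[of "[:1, -1:] ^ k * f" "k + D"] Suc by (simp only: power_Suc add_Suc mult.assoc) simp
qed simp

lemma homogenize_add_degree:
  assumes "degree f \<le> D"
  shows "homogenize (k + D) f = (X + Z) ^ k * homogenize D f"
  using assms by (induction k) (simp_all add: homogenize_Suc mult.assoc)

text \<open>The factor \<open>w\<close> serves both \<open>w = 1\<close> and
  \<open>w = (X + Z) ^ n\<close>; in the latter case only the product \<open>w * X ^ A\<close> is
  known to lie in \<open>W\<close>.\<close>

lemma homogenize_X_power_in_ideal:
  assumes "is_ideal W" "w * X ^ A \<in> W" "fits D A f"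
  shows "w * homogenize D ([:0, 1:] ^ A * f) \<in> W"
proof (cases "f = 0")
  case False
  then have "D = A + (D - A)" using assms(3) by (simp add: fits_def)
  then have "w * homogenize D ([:0, 1:] ^ A * f) = (w * X ^ A) * homogenize (D - A) f"
    using homogenize_X_power[of A "D - A" f] by (simp add: mult.assoc)
  then show ?thesis using is_ideal_mult_right[OF assms(1,2)] by simp
qed (simp add: is_ideal_zero assms)

lemma homogenize_Z_power_in_ideal:
  fixes f :: "'a::field poly"
  assumes "is_ideal W" "w * Z ^ A \<in> W" "fits D A f"
  shows "w * homogenize D ([:1, -1:] ^ A * f) \<in> W"
proof (cases "f = 0")
  case False
  then have "D = A + (D - A)" "degree f \<le> D - A" using assms(3) by (auto simp: fits_def)
  then have "w * homogenize D ([:1, -1:] ^ A * f) = (w * Z ^ A) * homogenize (D - A) f"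
    using homogenize_Z_power[of f "D - A" A] by (simp add: mult.assoc)
  then show ?thesis using is_ideal_mult_right[OF assms(1,2)] by simp
qed (simp add: is_ideal_zero assms)

section \<open>Monomials, linear functionals and homogeneous components\<close>

lemma mon_mult: "mon i j k * mon i' j' k' = mon (i + i') (j + j') (k + k')"
  by (simp add: mon_def mult_single)

lemma X_power: "X ^ i = mon i 0 0" and Y_power: "Y ^ j = mon 0 j 0" and Z_power: "Z ^ k = mon 0 0 k"
proof -
  have one: "mon 0 0 0 = 1" by (simp add: mon_def flip: single_one zero_prod_def)
  show "X ^ i = mon i 0 0" by (induction i) (simp_all add: one X_def mon_mult)
  show "Y ^ j = mon 0 j 0" by (induction j) (simp_all add: one Y_def mon_mult)
  show "Z ^ k = mon 0 0 k" by (induction k) (simp_all add: one Z_def mon_mult)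
qed

lemma mon_eq_powers: "mon i j k = X ^ i * Y ^ j * Z ^ k"
  by (simp add: X_power Y_power Z_power mon_mult)

lemma scal_mult_mon: "scal u * mon i j k = Poly_Mapping.single (i, j, k) u"
  by (simp add: scal_def mon_def mult_single)

lemma lookup_scal_mult: "Poly_Mapping.lookup (scal u * f) m = u * Poly_Mapping.lookup f m"
  by (simp add: scal_def mult_map_scale_conv_mult[symmetric] Poly_Mapping.map.rep_eq when_def)

lemma poly_mapping_eq_sum_single:
  "f = (\<Sum>m\<in>Poly_Mapping.keys f. Poly_Mapping.single m (Poly_Mapping.lookup f m))"
proof (rule poly_mapping_eqI)
  fix k
  show "Poly_Mapping.lookup f k = Poly_Mapping.lookup (\<Sum>m\<in>Poly_Mapping.keys f. Poly_Mapping.single m (Poly_Mapping.lookup f m)) k"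
    by (cases "k \<in> Poly_Mapping.keys f") (simp_all add: lookup_sum lookup_single when_def in_keys_iff)
qed

lemma in_ideal_if_monomials_in_ideal:
  assumes "is_ideal W" "\<And>i j k. (i, j, k) \<in> Poly_Mapping.keys f \<Longrightarrow> mon i j k \<in> W"
  shows "f \<in> W"
proof -
  have "Poly_Mapping.single m (Poly_Mapping.lookup f m) \<in> W" if "m \<in> Poly_Mapping.keys f" for m
    using that assms(2) is_ideal_mult[OF assms(1)] by (cases m) (metis scal_mult_mon)
  then have "(\<Sum>m\<in>Poly_Mapping.keys f. Poly_Mapping.single m (Poly_Mapping.lookup f m)) \<in> W"
    by (intro is_ideal_sum assms(1))
  then show ?thesis using poly_mapping_eq_sum_single[of f] by simp
qed

section \<open>Linear functionals given by their values on monomials\<close>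

definition weighted_sum :: "(nat \<times> nat \<times> nat \<Rightarrow> 'a) \<Rightarrow> 'a::comm_ring_1 poly3 \<Rightarrow> 'a" where
  "weighted_sum w f = (\<Sum>m\<in>Poly_Mapping.keys f. Poly_Mapping.lookup f m * w m)"

lemma weighted_sum_superset:
  assumes "finite S" "Poly_Mapping.keys f \<subseteq> S"
  shows "weighted_sum w f = (\<Sum>m\<in>S. Poly_Mapping.lookup f m * w m)"
  unfolding weighted_sum_def using assms
  by (intro sum.mono_neutral_left) (auto simp: in_keys_iff)

lemma weighted_sum_add: "weighted_sum w (f + g) = weighted_sum w f + weighted_sum w g"
proof -
  let ?S = "Poly_Mapping.keys f \<union> Poly_Mapping.keys g"
  have "weighted_sum w h = (\<Sum>m\<in>?S. Poly_Mapping.lookup h m * w m)" if "h \<in> {f, g, f + g}" for h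
    using that keys_add[of f g] by (intro weighted_sum_superset) auto
  then show ?thesis by (simp add: lookup_add distrib_right sum.distrib)
qed

lemma weighted_sum_0 [simp]: "weighted_sum w 0 = 0"
  by (simp add: weighted_sum_def)

lemma weighted_sum_diff: "weighted_sum w (f - g) = weighted_sum w f - weighted_sum w g"
  using weighted_sum_add[of w "f - g" g] by simp

lemma weighted_sum_sum: "weighted_sum w (\<Sum>i\<in>S. f i) = (\<Sum>i\<in>S. weighted_sum w (f i))"
  by (induction S rule: infinite_finite_induct) (simp_all add: weighted_sum_add)

lemma weighted_sum_single: "weighted_sum w (Poly_Mapping.single m u) = u * w m"
  by (cases "u = 0") (simp_all add: weighted_sum_def)

lemma weighted_sum_mon_mult:
  "weighted_sum w (mon i j k * f) = weighted_sum (\<lambda>m. w ((i, j, k) + m)) f"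
proof -
  have "mon i j k * f = (\<Sum>m\<in>Poly_Mapping.keys f. Poly_Mapping.single ((i, j, k) + m) (Poly_Mapping.lookup f m))"
    by (subst poly_mapping_eq_sum_single[of f]) (simp add: sum_distrib_left mon_def mult_single)
  then show ?thesis
    by (simp add: weighted_sum_sum weighted_sum_single) (simp add: weighted_sum_def)
qed

section \<open>Homogeneous components\<close>

definition hcomp :: "nat \<Rightarrow> 'a::comm_ring_1 poly3 \<Rightarrow> 'a poly3" where
  "hcomp D f = Poly_Mapping.mapp (\<lambda>m u. if mdeg m = D then u else 0) f"

lemma lookup_hcomp: "Poly_Mapping.lookup (hcomp D f) m = (if mdeg m = D then Poly_Mapping.lookup f m else 0)"
  by (simp add: hcomp_def lookup_mapp when_def in_keys_iff)

lemma homog_hcomp: "homog D (hcomp D f)"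
  by (auto simp: homog_def in_keys_iff lookup_hcomp split: if_splits)

lemma hcomp_homog: "homog D f \<Longrightarrow> hcomp D f = f"
  by (intro poly_mapping_eqI) (auto simp: homog_def in_keys_iff lookup_hcomp)

lemma hcomp_homog_other: "homog E f \<Longrightarrow> E \<noteq> D \<Longrightarrow> hcomp D f = 0"
  by (intro poly_mapping_eqI) (auto simp: homog_def in_keys_iff lookup_hcomp)

lemma hcomp_add: "hcomp D (f + g) = hcomp D f + hcomp D g"
  by (intro poly_mapping_eqI) (simp add: lookup_hcomp lookup_add)

lemma hcomp_0 [simp]: "hcomp D 0 = 0"
  by (intro poly_mapping_eqI) (simp add: lookup_hcomp)

lemma hcomp_sum: "hcomp D (\<Sum>i\<in>S. f i) = (\<Sum>i\<in>S. hcomp D (f i))"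
  by (induction S rule: infinite_finite_induct) (simp_all add: hcomp_add)

lemma mdeg_add: "mdeg (m + m') = mdeg m + mdeg m'"
  by (simp add: mdeg_def)

lemma homog_mult:
  assumes "homog D f" "homog E g"
  shows "homog (D + E) (f * g)"
  unfolding homog_def
proof
  fix m assume "m \<in> Poly_Mapping.keys (f * g)"
  then obtain m1 m2 where "m = m1 + m2" "m1 \<in> Poly_Mapping.keys f" "m2 \<in> Poly_Mapping.keys g"
    using keys_mult[of f g] by auto
  then show "mdeg m = D + E" using assms by (simp add: homog_def mdeg_add)
qed

lemma homog_single: "homog (mdeg m) (Poly_Mapping.single m u)"
  by (simp add: homog_def)

lemma hcomp_homog_mult:
  assumes "homog E g"
  shows "hcomp (E + D) (g * f) = g * hcomp D f"
proof -
  have single: "hcomp (E + D) (g * Poly_Mapping.single m u) = g * hcomp D (Poly_Mapping.single m u)" for m u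
    using homog_mult[OF assms homog_single[of m u]]
    by (cases "mdeg m = D") (auto simp: hcomp_homog homog_single hcomp_homog_other[OF homog_single] hcomp_homog_other)
  show ?thesis
    by (subst (1 2) poly_mapping_eq_sum_single[of f]) (simp only: sum_distrib_left hcomp_sum single)
qed

lemma weighted_sum_hcomp:
  "weighted_sum w (hcomp D f) = weighted_sum (\<lambda>m. if mdeg m = D then w m else 0) f"
proof -
  have "weighted_sum w (hcomp D f) = (\<Sum>m\<in>Poly_Mapping.keys f. Poly_Mapping.lookup (hcomp D f) m * w m)"
    by (rule weighted_sum_superset) (auto simp: in_keys_iff lookup_hcomp split: if_splits)
  also have "\<dots> = weighted_sum (\<lambda>m. if mdeg m = D then w m else 0) f"
    unfolding weighted_sum_def by (intro sum.cong) (auto simp: lookup_hcomp)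
  finally show ?thesis .
qed

lemma weighted_sum_cong:
  "(\<And>m. m \<in> Poly_Mapping.keys f \<Longrightarrow> w m = w' m) \<Longrightarrow> weighted_sum w f = weighted_sum w' f"
  by (simp add: weighted_sum_def)

section \<open>The Gorenstein duality\<close>

text \<open>Here \<open>n\<close>, \<open>g\<close>, \<open>p\<close>, \<open>q\<close> are b -
  \<beta>, \<gamma>, a - b + \<gamma>, c - \<gamma>. The additive equations avoid truncated
  subtraction.\<close>

locale pfaffian_ideal =
  fixes a b c n g p q :: nat
  assumes n_pos: "1 \<le> n" and n_less: "n < b"
    and g_less: "g < b" and p_eq: "p + b = a + g" and q_eq: "q + g = c"
begin

definition gens :: "'k::field_char_0 poly3 set" where
  "gens = {X ^ a, Y ^ b - X ^ (b - g) * Z ^ g, Z ^ c, X ^ p * Y ^ n, Y ^ n * Z ^ q}"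

abbreviation "I \<equiv> ideal_gen gens"

lemma ideal_I: "is_ideal I"
  by (rule ideal_gen_is_ideal)

lemma gens_subset: "gens \<subseteq> I"
  using generator_in_ideal_gen[of gens] by (auto simp: gens_def)

text \<open>The monomials equal to the socle generator \<open>x\<^bsup>a-1\<^esup> y\<^bsup>n-1\<^esup> z\<^bsup>c-1\<^esup>\<close> in the quotient.\<close>

definition socle_mon :: "nat \<times> nat \<times> nat \<Rightarrow> bool" where
  "socle_mon m \<longleftrightarrow> (case m of (i, j, k) \<Rightarrow>
     \<exists>r. i + r * (b - g) + 1 = a \<and> j + 1 = n + r * b \<and> k + r * g + 1 = c)"

text \<open>Each of the \<open>r\<close> exchanges of x^(b-g) z^g for y^b preserves the
  degree.\<close>

lemma socle_mon_degree:
  assumes "socle_mon m"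
  shows "mdeg m + 3 = a + n + c"
proof -
  obtain i j k r where m: "m = (i, j, k)" and r: "i + r * (b - g) + 1 = a" "j + 1 = n + r * b" "k + r * g + 1 = c"
    using assms by (cases m) (auto simp: socle_mon_def)
  have "r * b = r * (b - g) + r * g"
    using g_less by (simp add: distrib_left[symmetric])
  then show ?thesis using r by (simp add: m mdeg_def)
qed

lemma not_socle_mon_X: "\<not> socle_mon ((a, 0, 0) + m)"
  and not_socle_mon_Z: "\<not> socle_mon ((0, 0, c) + m)"
  by (cases m; auto simp: socle_mon_def)+

lemma not_socle_mon_XY: "\<not> socle_mon ((p, n, 0) + m)"
proof
  assume "socle_mon ((p, n, 0) + m)"
  \<comment> \<open>A y-exponent of at least \<open>n\<close> forces \<open>r\<close> to be
    positive, and then the x-exponent is too large because p + (b - g) = a.\<close>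
  then obtain i j r where r: "p + i + r * (b - g) + 1 = a" "n + j + 1 = n + r * b"
    by (cases m) (auto simp: socle_mon_def)
  then obtain s where "r = Suc s" by (cases r) auto
  then show False using r(1) p_eq g_less by simp
qed

lemma not_socle_mon_YZ: "\<not> socle_mon ((0, n, q) + m)"
proof
  assume "socle_mon ((0, n, q) + m)"
  then obtain j k r where r: "q + k + r * g + 1 = c" "n + j + 1 = n + r * b"
    by (cases m) (auto simp: socle_mon_def)
  then obtain s where "r = Suc s" by (cases r) auto
  then show False using r(1) q_eq by simp
qed

text \<open>The two sides correspond by shifting \<open>r\<close> by one; on the left
  \<open>r = 0\<close> is impossible since n < b.\<close>

lemma socle_mon_binomial: "socle_mon ((0, b, 0) + m) \<longleftrightarrow> socle_mon ((b - g, 0, g) + m)"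
proof (cases m)
  case (fields i j k)
  have "socle_mon ((0, b, 0) + m) \<longleftrightarrow>
      (\<exists>r. i + r * (b - g) + 1 = a \<and> b + j + 1 = n + r * b \<and> k + r * g + 1 = c)"
    by (simp add: fields socle_mon_def)
  also have "\<dots> \<longleftrightarrow> (\<exists>s. i + Suc s * (b - g) + 1 = a \<and> b + j + 1 = n + Suc s * b \<and> k + Suc s * g + 1 = c)"
    (is "(\<exists>r. ?P r) \<longleftrightarrow> (\<exists>s. ?P (Suc s))")
  proof -
    have "\<not> ?P 0" using n_less by simp
    then show ?thesis by (metis not0_implies_Suc)
  qed
  also have "\<dots> \<longleftrightarrow> socle_mon ((b - g, 0, g) + m)"
    by (simp add: fields socle_mon_def ac_simps)
  finally show ?thesis .
qed

text \<open>Macaulay's inverse system: \<open>I\<close> will turn out to be the annihilator of the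
  sum of all \<open>socle_mon\<close> monomials, and this functional pairs with that sum.\<close>

definition socle_form :: "'k::field_char_0 poly3 \<Rightarrow> 'k" where
  "socle_form = weighted_sum (\<lambda>m. of_bool (socle_mon m))"

lemma socle_form_mon_mult_eq_0:
  assumes "\<And>m. \<not> socle_mon ((i, j, k) + m)"
  shows "socle_form (mon i j k * f) = 0"
  using assms by (simp add: socle_form_def weighted_sum_mon_mult) (simp add: weighted_sum_def)

lemma socle_form_generator:
  assumes "h \<in> gens"
  shows "socle_form (h * f) = 0"
proof -
  consider "h = mon a 0 0" | "h = mon 0 b 0 - mon (b - g) 0 g" | "h = mon 0 0 c" | "h = mon p n 0" | "h = mon 0 n q"
    using assms by (auto simp: gens_def X_power Y_power Z_power mon_mult)
  then show ?thesis
  proof cases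
    case 2
    then show ?thesis
      by (simp add: socle_form_def left_diff_distrib weighted_sum_diff weighted_sum_mon_mult socle_mon_binomial)
  qed (simp_all add: socle_form_mon_mult_eq_0 not_socle_mon_X not_socle_mon_Z not_socle_mon_XY not_socle_mon_YZ)
qed

lemma socle_form_ideal:
  assumes "h \<in> I"
  shows "socle_form h = 0"
proof -
  obtain u where "h = (\<Sum>v\<in>gens. u v * v)" using assms by (auto simp: ideal_gen_def)
  then have "socle_form h = (\<Sum>v\<in>gens. socle_form (v * u v))"
    by (simp add: socle_form_def weighted_sum_sum mult.commute)
  then show ?thesis by (simp add: socle_form_generator)
qed

section \<open>Normal forms and nondegeneracy of the pairing\<close>

definition standard_mon :: "nat \<times> nat \<times> nat \<Rightarrow> bool" where
  "standard_mon m \<longleftrightarrow> (case m of (i, j, k) \<Rightarrow>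
     i < a \<and> j < b \<and> k < c \<and> (j < n \<or> i < p \<and> k < q))"

text \<open>Rewriting y^b to x^(b-g) z^g lowers the y-exponent. Once it is below \<open>b\<close>, a
  nonstandard monomial is a multiple of a monomial generator.\<close>

lemma mon_normal_form:
  "\<exists>f :: 'k::field_char_0 poly3. mon i j k - f \<in> I \<and> (\<forall>m\<in>Poly_Mapping.keys f. standard_mon m)"
proof (induction j arbitrary: i k rule: less_induct)
  case (less j)
  show ?case
  proof (cases "j < b")
    case False
    then have "j - b < j" using n_less by simp
    then obtain f :: "'k poly3" where f: "mon (b - g + i) (j - b) (g + k) - f \<in> I" "\<forall>m\<in>Poly_Mapping.keys f. standard_mon m"
      using less by blast
    have "mon i (j - b) k * (Y ^ b - X ^ (b - g) * Z ^ g) \<in> (I :: 'k poly3 set)"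
      using gens_subset by (intro is_ideal_mult ideal_I) (auto simp: gens_def)
    moreover have "mon i (j - b) k * (Y ^ b - X ^ (b - g) * Z ^ g) = (mon i j k - mon (b - g + i) (j - b) (g + k) :: 'k poly3)"
      using False by (simp add: X_power Y_power Z_power mon_mult right_diff_distrib ac_simps)
    ultimately have "mon i j k - f \<in> I"
      using is_ideal_add[OF ideal_I _ f(1), of "mon i j k - mon (b - g + i) (j - b) (g + k)"] by simp
    then show ?thesis using f(2) by blast
  next
    case True
    show ?thesis
    proof (cases "standard_mon (i, j, k)")
      case True
      then show ?thesis
        by (intro exI[of _ "mon i j k"]) (simp add: is_ideal_zero[OF ideal_I] mon_def)
    next
      case False
      have dvd: "mon i j k \<in> (I :: 'k poly3 set)" if "mon i' j' k' \<in> (I :: 'k poly3 set)" "i' \<le> i" "j' \<le> j" "k' \<le> k" for i' j' k'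
        using is_ideal_mult[OF ideal_I that(1), of "mon (i - i') (j - j') (k - k')"] that
        by (simp add: mon_mult)
      have "{mon a 0 0, mon 0 0 c, mon p n 0, mon 0 n q} \<subseteq> (I :: 'k poly3 set)"
        using gens_subset by (auto simp: gens_def X_power Y_power Z_power mon_mult)
      then have "mon i j k \<in> (I :: 'k poly3 set)"
        using False \<open>j < b\<close> by (auto simp: standard_mon_def not_less intro: dvd)
      then show ?thesis by (intro exI[of _ 0]) simp
    qed
  qed
qed

lemma normal_form:
  fixes f :: "'k::field_char_0 poly3"
  shows "\<exists>f'. f - f' \<in> I \<and> (\<forall>m\<in>Poly_Mapping.keys f'. standard_mon m)"
proof -
  have "\<exists>h :: _ \<Rightarrow> 'k poly3. \<forall>m. (case m of (i, j, k) \<Rightarrow> mon i j k) - h m \<in> I \<and> (\<forall>m'\<in>Poly_Mapping.keys (h m). standard_mon m')"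
    using mon_normal_form by (intro choice) (auto split: prod.split)
  then obtain h :: "_ \<Rightarrow> 'k poly3" where h: "\<And>i j k. mon i j k - h (i, j, k) \<in> I"
      "\<And>m m'. m' \<in> Poly_Mapping.keys (h m) \<Longrightarrow> standard_mon m'"
    by (metis (no_types, lifting) case_prod_conv)
  let ?c = "Poly_Mapping.lookup f"
  define f' where "f' = (\<Sum>m\<in>Poly_Mapping.keys f. scal (?c m) * h m)"
  have "f - f' = (\<Sum>m\<in>Poly_Mapping.keys f. Poly_Mapping.single m (?c m) - scal (?c m) * h m)"
    unfolding f'_def sum_subtractf using poly_mapping_eq_sum_single[of f] by simp
  moreover have "Poly_Mapping.single m (?c m) - scal (?c m) * h m \<in> I" for m
  proof (cases m)
    case (fields i j k)
    have "scal (?c m) * (mon i j k - h (i, j, k)) \<in> I" by (intro is_ideal_mult ideal_I h)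
    then show ?thesis by (simp add: fields right_diff_distrib scal_mult_mon)
  qed
  ultimately have "f - f' \<in> I" by (simp add: is_ideal_sum ideal_I)
  moreover have "standard_mon m" if "m \<in> Poly_Mapping.keys f'" for m
  proof (rule ccontr)
    assume "\<not> standard_mon m"
    then have "Poly_Mapping.lookup (h m') m = 0" for m' using h(2) by (metis in_keys_iff)
    then have "Poly_Mapping.lookup f' m = 0" by (simp add: f'_def lookup_sum lookup_scal_mult)
    then show False using that by (simp add: in_keys_iff)
  qed
  ultimately show ?thesis by blast
qed

text \<open>The witness is the complement of \<open>m\<close> in a socle monomial. For j < n this is
  the one with \<open>r = 0\<close>; otherwise its y-exponent n - 1 is too small, and the one with
  \<open>r = 1\<close>, x^(p-1) y^(b+n-1) z^(q-1), is used.\<close>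

lemma standard_mon_dual:
  assumes "standard_mon m"
  shows "\<exists>i' j' k'. \<forall>m'. standard_mon m' \<longrightarrow> (socle_mon ((i', j', k') + m') \<longleftrightarrow> m' = m)"
proof -
  obtain i j k where m: "m = (i, j, k)" by (cases m)
  have s: "i < a" "j < b" "k < c" "j < n \<or> i < p \<and> k < q" using assms by (auto simp: m standard_mon_def)
  show ?thesis
  proof (cases "j < n")
    case True
    have "socle_mon ((a - 1 - i, n - 1 - j, c - 1 - k) + m') \<longleftrightarrow> m' = m" if "standard_mon m'" for m'
    proof -
      obtain x y z where m': "m' = (x, y, z)" by (cases m')
      have y: "y < b" using that by (simp add: m' standard_mon_def)
      have "socle_mon ((a - 1 - i, n - 1 - j, c - 1 - k) + m') \<longleftrightarrow>
          (\<exists>r. x + r * (b - g) = i \<and> y = j + r * b \<and> z + r * g = k)"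
        unfolding m' socle_mon_def using s True by (simp, intro ex_cong1) auto
      also have "\<dots> \<longleftrightarrow> m' = m"
      proof
        assume "\<exists>r. x + r * (b - g) = i \<and> y = j + r * b \<and> z + r * g = k"
        then obtain r where r: "x + r * (b - g) = i" "y = j + r * b" "z + r * g = k" by blast
        have "r = 0" using r(2) y by (cases r) auto
        then show "m' = m" using r by (simp add: m m')
      qed (auto simp: m m' intro: exI[of _ 0])
      finally show ?thesis .
    qed
    then show ?thesis by blast
  next
    case False
    then have s': "i < p" "k < q" "n \<le> j" using s by auto
    have pb: "p + (b - g) = a" using p_eq g_less by simp
    have "socle_mon ((p - 1 - i, b + n - 1 - j, q - 1 - k) + m') \<longleftrightarrow> m' = m" if "standard_mon m'" for m'
    proof -
      obtain x y z where m': "m' = (x, y, z)" by (cases m')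
      have y: "y < b" using that by (simp add: m' standard_mon_def)
      have "socle_mon ((p - 1 - i, b + n - 1 - j, q - 1 - k) + m') \<longleftrightarrow>
          (\<exists>r. x + r * (b - g) = i + (b - g) \<and> b + y = j + r * b \<and> z + r * g = k + g)"
        unfolding m' socle_mon_def using s s' pb q_eq by (simp, intro ex_cong1) auto
      also have "\<dots> \<longleftrightarrow> m' = m"
      proof
        assume "\<exists>r. x + r * (b - g) = i + (b - g) \<and> b + y = j + r * b \<and> z + r * g = k + g"
        then obtain r where r: "x + r * (b - g) = i + (b - g)" "b + y = j + r * b" "z + r * g = k + g" by blast
        consider "r = 0" | "r = 1" | t where "r = Suc (Suc t)" by (metis One_nat_def not0_implies_Suc)
        then have "r = 1" using r(2) y s by cases auto
        then show "m' = m" using r by (simp add: m m')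
      qed (auto simp: m m' intro: exI[of _ 1])
      finally show ?thesis .
    qed
    then show ?thesis by blast
  qed
qed

text \<open>Pairing a normal form of \<open>f\<close> with the dual of each standard monomial reads
  off its coefficients, so all of them vanish.\<close>

lemma in_ideal_if_socle_form_eq_0:
  assumes "\<And>i j k. socle_form (mon i j k * f) = 0"
  shows "f \<in> I"
proof -
  obtain f' where f': "f - f' \<in> I" "\<And>m. m \<in> Poly_Mapping.keys f' \<Longrightarrow> standard_mon m"
    using normal_form by blast
  have zero: "socle_form (mon i j k * f') = 0" for i j k
    using socle_form_ideal[OF is_ideal_mult[OF ideal_I f'(1), of "mon i j k"]] assms[of i j k]
    by (simp add: right_diff_distrib socle_form_def weighted_sum_diff)
  have "m \<notin> Poly_Mapping.keys f'" for m
  proof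
    assume m: "m \<in> Poly_Mapping.keys f'"
    then obtain i' j' k' where dual: "\<And>m'. standard_mon m' \<Longrightarrow> socle_mon ((i', j', k') + m') \<longleftrightarrow> m' = m"
      using standard_mon_dual f'(2) by metis
    have "socle_form (mon i' j' k' * f')
        = (\<Sum>m'\<in>Poly_Mapping.keys f'. Poly_Mapping.lookup f' m' * of_bool (m' = m))"
      unfolding socle_form_def weighted_sum_mon_mult unfolding weighted_sum_def
      by (intro sum.cong) (auto simp: dual f'(2))
    also have "\<dots> = Poly_Mapping.lookup f' m"
      using m by (simp add: of_bool_def if_distrib cong: if_cong)
    finally show False using zero m by (simp add: in_keys_iff)
  qed
  then have "f' = 0" by (metis equals0I keys_eq_empty)
  then show ?thesis using f'(1) by simp
qed

text \<open>\<open>socle_form\<close> sees a single degree. Against a monomial of complementary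
  degree the component pairs as \<open>h\<close> does; against any other it pairs to 0.\<close>

lemma hcomp_in_ideal:
  assumes "h \<in> I"
  shows "hcomp D h \<in> I"
proof (rule in_ideal_if_socle_form_eq_0)
  fix i j k
  let ?w = "\<lambda>m. of_bool (socle_mon ((i, j, k) + m))"
  have eq: "socle_form (mon i j k * hcomp D h) = weighted_sum (\<lambda>m. if mdeg m = D then ?w m else 0) h"
    by (simp add: socle_form_def weighted_sum_mon_mult weighted_sum_hcomp)
  have deg: "mdeg (i, j, k) + mdeg m + 3 = a + n + c" if "socle_mon ((i, j, k) + m)" for m
    using socle_mon_degree[OF that] by (simp add: mdeg_def)
  show "socle_form (mon i j k * hcomp D h) = 0"
  proof (cases "mdeg (i, j, k) + D + 3 = a + n + c")
    case True
    have "weighted_sum (\<lambda>m. if mdeg m = D then ?w m else 0) h = weighted_sum ?w h"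
      using deg True by (intro weighted_sum_cong) fastforce
    also have "\<dots> = socle_form (mon i j k * h)"
      by (simp add: socle_form_def weighted_sum_mon_mult)
    also have "\<dots> = 0" by (intro socle_form_ideal is_ideal_mult ideal_I assms)
    finally show ?thesis using eq by simp
  next
    case False
    have "weighted_sum (\<lambda>m. if mdeg m = D then ?w m else 0) h = weighted_sum (\<lambda>m. 0) h"
      using deg False by (intro weighted_sum_cong) fastforce
    then show ?thesis using eq by (simp add: weighted_sum_def)
  qed
qed

end

section \<open>The weak Lefschetz property\<close>

lemma homogenize_monom:
  "i \<le> d \<Longrightarrow> homogenize d ([:0, 1:] ^ i) = (X ^ i * (X + Z) ^ (d - i) :: 'a::comm_ring_1 poly3)"
  using homogenize_X_power[of i "d - i" "1 :: 'a poly"] homogenize_add_degree[of "1 :: 'a poly" 0 "d - i"]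
  by (simp add: homogenize_1)

context pfaffian_ideal
begin

lemma linear_form_power_mod:
  fixes W :: "'k::field_char_0 poly3 set"
  assumes "is_ideal W" "X + Z - scal t * Y \<in> W"
  shows "(X + Z) ^ k - scal (t ^ k) * Y ^ k \<in> W"
  using is_ideal_power_diff[OF assms, of k] by (simp add: power_mult_distrib scal_power)

text \<open>Two applications of the three-powers decomposition leave a multiple of l^b, which equals
  t^b x^(b-g) z^g modulo \<open>W\<close>. That \<open>u\<close> depends on neither \<open>t\<close>
  nor \<open>W\<close> is what makes the later elimination possible.\<close>

lemma monomial_reduction:
  assumes "a + c + n \<le> 2 * d + 2" "i \<le> d"
  shows "\<exists>u. \<forall>t W. is_ideal W \<longrightarrow> gens \<subseteq> W \<longrightarrow> X + Z - scal t * Y \<in> W \<longrightarrow>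
    X ^ i * (X + Z) ^ (d - i) - scal (t ^ b) * homogenize d u \<in> (W :: 'k::field_char_0 poly3 set)"
proof -
  let ?x = "[:0, 1:] :: 'k poly" and ?z = "[:1, -1:] :: 'k poly"
  have "degree (?x ^ i) \<le> d" using assms(2) by (simp add: degree_power_eq)
  then obtain \<alpha> \<beta> f where f: "?x ^ i = ?x ^ a * \<alpha> + ?z ^ c * \<beta> + f" "fits d a \<alpha>" "fits d c \<beta>" "fits d n f"
    using three_powers_decomposition[of a c n d "?x ^ i"] assms(1) by auto
  have first: "X ^ i * (X + Z) ^ (d - i) - homogenize d f \<in> W" if "is_ideal W" "gens \<subseteq> W" for W :: "'k poly3 set"
  proof -
    have "X ^ i * (X + Z) ^ (d - i) - homogenize d f
        = 1 * homogenize d (?x ^ a * \<alpha>) + 1 * homogenize d (?z ^ c * \<beta>)"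
      unfolding homogenize_monom[OF assms(2), symmetric] f(1) homogenize_add by simp
    moreover have "1 * homogenize d (?x ^ a * \<alpha>) \<in> W"
      using that f by (intro homogenize_X_power_in_ideal) (auto simp: gens_def)
    moreover have "1 * homogenize d (?z ^ c * \<beta>) \<in> W"
      using that f by (intro homogenize_Z_power_in_ideal) (auto simp: gens_def)
    ultimately show ?thesis using that(1) by (simp add: is_ideal_add)
  qed
  show ?thesis
  \<comment> \<open>By the convention in \<open>fits\<close>, this also covers d < n, where
    \<open>d - n\<close> would be truncated.\<close>
  proof (cases "f = 0")
    case True
    then show ?thesis using first by (intro exI[of _ 0]) simp
  next
    case False
    define d' where "d' = d - n"
    have d: "d = n + d'" and deg: "degree f \<le> d'" using f(4) False by (auto simp: fits_def d'_def)
    \<comment> \<open>As p + q = a + c - b, the left side is a + c - n: both sides of the assumption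
      drop by 2n.\<close>
    have "p + q + (b - n) \<le> 2 * d' + 2" using assms(1) p_eq q_eq n_less d by linarith
    then obtain \<alpha>' \<beta>' h where h: "f = ?x ^ p * \<alpha>' + ?z ^ q * \<beta>' + h" "fits d' p \<alpha>'" "fits d' q \<beta>'" "fits d' (b - n) h"
      using three_powers_decomposition[of p q "b - n" d' f] deg by auto
    have second: "homogenize d f - (X + Z) ^ n * homogenize d' h \<in> W"
      if W: "is_ideal W" "gens \<subseteq> W" "X + Z - scal t * Y \<in> W" for t and W :: "'k poly3 set"
    proof -
      have "homogenize d f - (X + Z) ^ n * homogenize d' h
          = (X + Z) ^ n * homogenize d' (?x ^ p * \<alpha>') + (X + Z) ^ n * homogenize d' (?z ^ q * \<beta>')"
        unfolding d homogenize_add_degree[OF deg] by (subst h(1)) (simp add: homogenize_add distrib_left)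
      moreover have yw: "((X + Z) ^ n - scal (t ^ n) * Y ^ n) * w \<in> W" for w
        by (intro is_ideal_mult_right linear_form_power_mod W)
      have "scal (t ^ n) * (X ^ p * Y ^ n) \<in> W" "scal (t ^ n) * (Y ^ n * Z ^ q) \<in> W"
        using W by (auto intro!: is_ideal_mult simp: gens_def)
      then have "((X + Z) ^ n - scal (t ^ n) * Y ^ n) * X ^ p + scal (t ^ n) * (X ^ p * Y ^ n) \<in> W"
          "((X + Z) ^ n - scal (t ^ n) * Y ^ n) * Z ^ q + scal (t ^ n) * (Y ^ n * Z ^ q) \<in> W"
        by (intro is_ideal_add[OF W(1)] yw; simp)+
      then have "(X + Z) ^ n * X ^ p \<in> W" "(X + Z) ^ n * Z ^ q \<in> W"
        by (simp_all add: algebra_simps)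
      then have "(X + Z) ^ n * homogenize d' (?x ^ p * \<alpha>') \<in> W" "(X + Z) ^ n * homogenize d' (?z ^ q * \<beta>') \<in> W"
        using h W(1) by (auto intro: homogenize_X_power_in_ideal homogenize_Z_power_in_ideal)
      ultimately show ?thesis using W(1) by (simp add: is_ideal_add)
    qed
    show ?thesis
    proof (cases "h = 0")
      case True
      have "X ^ i * (X + Z) ^ (d - i) \<in> W"
        if "is_ideal W" "gens \<subseteq> W" "X + Z - scal t * Y \<in> W" for t and W :: "'k poly3 set"
        using is_ideal_add[OF that(1) first[OF that(1,2)] second[OF that]] True by simp
      then show ?thesis by (intro exI[of _ 0]) auto
    next
      case False
      define d'' where "d'' = d - b"
      have d'': "d' = (b - n) + d''" "d = b + d''" and deg_h: "degree h \<le> d''"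
        using h(4) False d n_less by (auto simp: fits_def d''_def)
      \<comment> \<open>The dehomogenized x^(b-g) z^g h, which replaces l^b h up to the factor
        t^b.\<close>
      define u where "u = ?x ^ (b - g) * (?z ^ g * h)"
      have u: "homogenize d u = X ^ (b - g) * Z ^ g * homogenize d'' h"
        unfolding u_def using homogenize_X_power[of "b - g" "g + d''" "?z ^ g * h"]
          homogenize_Z_power[OF deg_h, of g] g_less by (simp add: d''(2) mult.assoc)
      have "X ^ i * (X + Z) ^ (d - i) - scal (t ^ b) * homogenize d u \<in> W"
        if W: "is_ideal W" "gens \<subseteq> W" "X + Z - scal t * Y \<in> W" for t and W :: "'k poly3 set"
      proof -
        have "(X + Z) ^ n * homogenize d' h = (X + Z) ^ (n + (b - n)) * homogenize d'' h"
          unfolding d''(1) homogenize_add_degree[OF deg_h] by (simp add: power_add mult.assoc)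
        then have eq: "(X + Z) ^ n * homogenize d' h = (X + Z) ^ b * homogenize d'' h"
          using n_less by simp
        have "Y ^ b - X ^ (b - g) * Z ^ g \<in> W" using W by (auto simp: gens_def)
        then have "(X + Z) ^ b - scal (t ^ b) * Y ^ b + scal (t ^ b) * (Y ^ b - X ^ (b - g) * Z ^ g) \<in> W"
          using W by (intro is_ideal_add is_ideal_mult linear_form_power_mod) auto
        then have "((X + Z) ^ b - scal (t ^ b) * Y ^ b + scal (t ^ b) * (Y ^ b - X ^ (b - g) * Z ^ g)) * homogenize d'' h \<in> W"
          by (rule is_ideal_mult_right[OF W(1)])
        moreover have "((X + Z) ^ b - scal (t ^ b) * Y ^ b + scal (t ^ b) * (Y ^ b - X ^ (b - g) * Z ^ g)) * homogenize d'' h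
           = (X + Z) ^ n * homogenize d' h - scal (t ^ b) * homogenize d u"
          unfolding eq u by (simp add: algebra_simps)
        ultimately have "(X + Z) ^ n * homogenize d' h - scal (t ^ b) * homogenize d u \<in> W" by simp
        from is_ideal_add[OF W(1) is_ideal_add[OF W(1) first[OF W(1,2)] second[OF W]] this]
        show ?thesis by simp
      qed
      then show ?thesis by blast
    qed
  qed
qed

text \<open>The reductions form a square system e = t M e, solvable by e = 0 for generic
  \<open>t\<close>. Since the e_i span the forms of degree \<open>d\<close> in x and z, it remains
  to trade y^j for l^j.\<close>

lemma exists_linear_form:
  assumes "a + c + n \<le> 2 * d + 2"
  shows "\<exists>t. \<forall>W. is_ideal W \<longrightarrow> gens \<subseteq> W \<longrightarrow> X + Z - scal t * Y \<in> W \<longrightarrow>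
    (\<forall>i j k. i + j + k = d \<longrightarrow> mon i j k \<in> (W :: 'k::field_char_0 poly3 set))"
proof -
  let ?Q = "\<lambda>i u. \<forall>t W. is_ideal W \<longrightarrow> gens \<subseteq> W \<longrightarrow> X + Z - scal t * Y \<in> W \<longrightarrow>
    X ^ i * (X + Z) ^ (d - i) - scal (t ^ b) * homogenize d u \<in> (W :: 'k poly3 set)"
  have "\<forall>i. \<exists>u. i \<le> d \<longrightarrow> ?Q i u"
    using monomial_reduction[OF assms, where 'k = 'k] by blast
  then have "\<exists>u. \<forall>i. i \<le> d \<longrightarrow> ?Q i (u i)" by (rule choice)
  then obtain u where u: "\<forall>i. i \<le> d \<longrightarrow> ?Q i (u i)" by (rule exE)
  define e :: "nat \<Rightarrow> 'k poly3" where "e i = X ^ i * (X + Z) ^ (d - i)" for i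
  have hom_e: "homogenize d f = (\<Sum>j<Suc d. scal (coeff f j) * e j)" for f
    by (simp add: homogenize_def e_def lessThan_Suc_atMost)
  \<comment> \<open>One factor t of t^b is the explicit one in \<open>generic_elimination\<close>,
    hence the exponent b - 1.\<close>
  define M where "M i j = monom (coeff (u i) j) (b - 1)" for i j
  obtain P where P0: "poly P 0 = 1" and P: "\<forall>t W e. poly P t \<noteq> 0 \<longrightarrow> is_ideal W \<longrightarrow>
     (\<forall>i<Suc d. e i - scal t * (\<Sum>j<Suc d. scal (poly (M i j) t) * e j) \<in> W) \<longrightarrow> (\<forall>i<Suc d. e i \<in> W)"
    using generic_elimination[of "Suc d" M] by (elim exE conjE)
  \<comment> \<open>The extra factor also excludes \<open>t = 0\<close>, so that powers of
    \<open>t\<close> can be cancelled at the end.\<close>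
  have "[:0, 1:] * P \<noteq> 0" using P0 by auto
  then have "finite {t. poly ([:0, 1:] * P) t = 0}" by (rule poly_roots_finite)
  then obtain t where "poly ([:0, 1:] * P) t \<noteq> 0"
    using infinite_UNIV_char_0[where 'a = 'k] by (metis (mono_tags, lifting) UNIV_eq_I mem_Collect_eq)
  then have t: "t \<noteq> 0" "poly P t \<noteq> 0" by auto
  have "mon i j k \<in> W" if W: "is_ideal W" "gens \<subseteq> W" "X + Z - scal t * Y \<in> W" and ijk: "i + j + k = d"
    for i j k and W :: "'k poly3 set"
  proof -
    have "e i - scal t * (\<Sum>j<Suc d. scal (poly (M i j) t) * e j) \<in> W" if "i < Suc d" for i
    proof -
      have "t * poly (M i j) t = t ^ b * coeff (u i) j" for j
        using n_less by (cases b) (simp_all add: M_def poly_monom)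
      then have "scal t * (scal (poly (M i j) t) * e j) = scal (t ^ b) * (scal (coeff (u i) j) * e j)" for j
        by (simp add: mult.assoc[symmetric] scal_mult[symmetric])
      then have "scal t * (\<Sum>j<Suc d. scal (poly (M i j) t) * e j) = scal (t ^ b) * homogenize d (u i)"
        unfolding hom_e sum_distrib_left by simp
      moreover have "X ^ i * (X + Z) ^ (d - i) - scal (t ^ b) * homogenize d (u i) \<in> W"
        using u that W by simp
      ultimately show ?thesis by (simp only: e_def)
    qed
    then have e: "\<forall>i<Suc d. e i \<in> W"
      using P t(2) W(1) by blast
    have "homogenize d ([:0, 1:] ^ i * [:1, -1:] ^ k) = (X ^ i * (Z ^ k * (X + Z) ^ j) :: 'k poly3)"
      using homogenize_X_power[of i "k + j" "[:1, -1:] ^ k :: 'k poly"] homogenize_Z_power[of "1 :: 'k poly" j k]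
        homogenize_add_degree[of "1 :: 'k poly" 0 j] ijk
      by (simp add: homogenize_1 ac_simps)
    moreover have "homogenize d f \<in> W" for f
      unfolding hom_e using e by (intro is_ideal_sum is_ideal_mult W(1)) auto
    ultimately have 1: "X ^ i * (Z ^ k * (X + Z) ^ j) \<in> W" by metis
    have "X ^ i * Z ^ k * ((X + Z) ^ j - scal (t ^ j) * Y ^ j) \<in> W"
      by (intro is_ideal_mult linear_form_power_mod W)
    moreover have "X ^ i * Z ^ k * ((X + Z) ^ j - scal (t ^ j) * Y ^ j)
        = X ^ i * (Z ^ k * (X + Z) ^ j) - scal (t ^ j) * mon i j k"
      by (simp add: mon_eq_powers algebra_simps)
    ultimately have "scal (t ^ j) * mon i j k \<in> W"
      using 1 is_ideal_diff_iff[OF W(1)] by metis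
    then show ?thesis using t(1) W(1) is_ideal_scal_cancel[of W "t ^ j"] by simp
  qed
  then show ?thesis by blast
qed

lemma has_WLP_I: "has_WLP (I :: 'k::field_char_0 poly3 set)"
proof -
  \<comment> \<open>The least degree with a + c + n \<le> 2d + 2.\<close>
  define d where "d = (a + c + n - 1) div 2"
  have "a + c + n \<le> 2 * d + 2" by (simp add: d_def)
  from exists_linear_form[OF this, where 'k = 'k]
  obtain t where t: "\<forall>W. is_ideal W \<longrightarrow> gens \<subseteq> W \<longrightarrow> X + Z - scal t * Y \<in> W \<longrightarrow>
      (\<forall>i j k. i + j + k = d \<longrightarrow> mon i j k \<in> (W :: 'k poly3 set))" by (rule exE)
  define L where "L = X + Z - scal t * Y"
  \<comment> \<open>This is the ideal (I, L); it contains every monomial of degree at least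
    \<open>d\<close>.\<close>
  define W where "W = {L * f + h |f h. h \<in> (I :: 'k poly3 set)}"
  have W: "is_ideal W" unfolding W_def by (intro is_ideal_plus_principal ideal_I)
  have "L * 0 + h \<in> W" if "h \<in> I" for h using that unfolding W_def by blast
  then have "I \<subseteq> W" by auto
  moreover have "L * 1 + 0 \<in> W" unfolding W_def using is_ideal_zero[OF ideal_I] by blast
  ultimately have "gens \<subseteq> W" "X + Z - scal t * Y \<in> W"
    using gens_subset by (auto simp: L_def)
  then have d: "mon i j k \<in> W" if "i + j + k = d" for i j k
    using t W that by simp
  have mon_W: "mon i j k \<in> W" if ijk: "d \<le> i + j + k" for i j k
  proof -
    have "\<exists>i' j' k'. i' \<le> i \<and> j' \<le> j \<and> k' \<le> k \<and> i' + j' + k' = d"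
      using ijk by (intro exI[of _ "min i d"] exI[of _ "min j (d - min i d)"]
          exI[of _ "d - min i d - min j (d - min i d)"]) auto
    then obtain i' j' k' where le: "i' \<le> i" "j' \<le> j" "k' \<le> k" and "i' + j' + k' = d" by blast
    then have "mon (i - i') (j - j') (k - k') * mon i' j' k' \<in> W" by (intro is_ideal_mult W d)
    then show ?thesis using le by (simp add: mon_mult)
  qed
  have L: "homog 1 L"
  proof -
    have "homog 1 (X :: 'k poly3)" "homog 1 (Z :: 'k poly3)" "homog 1 (scal t * Y)"
      by (auto simp: X_def Y_def Z_def scal_mult_mon) (auto simp: homog_def mon_def mdeg_def)
    then show ?thesis
      unfolding L_def homog_def using keys_diff[of "X + Z" "scal t * Y"] keys_add[of "X :: 'k poly3" Z] by blast
  qed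
  have surj: "mult_surjective I L i" if i: "d \<le> Suc i" for i
    unfolding mult_surjective_def
  proof (intro allI impI)
    fix v :: "'k poly3" assume v: "homog (Suc i) v"
    have "v \<in> W"
    proof (rule in_ideal_if_monomials_in_ideal[OF W])
      fix x y z assume "(x, y, z) \<in> Poly_Mapping.keys v"
      then show "mon x y z \<in> W" using v i by (intro mon_W) (auto simp: homog_def mdeg_def)
    qed
    then obtain f h where fh: "v = L * f + h" "h \<in> I" unfolding W_def by blast
    \<comment> \<open>The preimage \<open>f\<close> need not be homogeneous; its component of degree
      \<open>i\<close> is a preimage as well, \<open>I\<close> being homogeneous.\<close>
    have "v = hcomp (1 + i) v" using hcomp_homog[OF v] by simp
    also have "\<dots> = L * hcomp i f + hcomp (1 + i) h"
      unfolding fh(1) hcomp_add hcomp_homog_mult[OF L] ..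
    finally have "v - L * hcomp i f = hcomp (1 + i) h" by (metis add_diff_cancel_left')
    then show "\<exists>f. homog i f \<and> v - L * f \<in> I"
      using hcomp_in_ideal[OF fh(2)] homog_hcomp by metis
  qed
  have inj: "mult_injective I L i" if i: "i + d + 3 \<le> a + n + c" for i
    unfolding mult_injective_def
  proof (intro allI impI, elim conjE)
    fix f :: "'k poly3" assume f: "homog i f" "L * f \<in> I"
    show "f \<in> I"
    proof (rule in_ideal_if_socle_form_eq_0)
      fix x y z
      show "socle_form (mon x y z * f) = 0"
      proof (cases "x + y + z + i + 3 = a + n + c")
        case True
        \<comment> \<open>The complementary degree is at least \<open>d\<close>, so the monomial is
          a multiple of \<open>L\<close> modulo \<open>I\<close>, and \<open>L * f\<close> lies in
          \<open>I\<close>.\<close>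
        then have "mon x y z \<in> W" using i by (intro mon_W) simp
        then obtain f' h where fh: "mon x y z = L * f' + h" "h \<in> I" unfolding W_def by blast
        have "f' * (L * f) + f * h \<in> I"
          by (rule is_ideal_add[OF ideal_I is_ideal_mult[OF ideal_I f(2)] is_ideal_mult[OF ideal_I fh(2)]])
        also have "f' * (L * f) + f * h = mon x y z * f" unfolding fh(1) by (simp add: algebra_simps)
        finally show ?thesis by (rule socle_form_ideal)
      next
        case False
        have "\<not> socle_mon ((x, y, z) + m)" if "m \<in> Poly_Mapping.keys f" for m
        proof
          assume "socle_mon ((x, y, z) + m)"
          then have "mdeg (x, y, z) + mdeg m + 3 = a + n + c"
            using socle_mon_degree unfolding mdeg_add[symmetric] by blast
          moreover have "mdeg m = i" using f(1) that by (simp add: homog_def)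
          ultimately show False using False by (simp add: mdeg_def)
        qed
        then have "weighted_sum (\<lambda>m. of_bool (socle_mon ((x, y, z) + m)) :: 'k) f = weighted_sum (\<lambda>m. 0) f"
          by (intro weighted_sum_cong) simp
        then show ?thesis
          unfolding socle_form_def weighted_sum_mon_mult by (simp add: weighted_sum_def)
      qed
    qed
  qed
  \<comment> \<open>No degree is missed, because 2d \<le> a + c + n - 1.\<close>
  have "d \<le> Suc i \<or> i + d + 3 \<le> a + n + c" for i
    using n_pos unfolding d_def by linarith
  then show ?thesis unfolding has_WLP_def using L surj inj by blast
qed

end

theorem theorem4p3:
  fixes a b c \<beta> \<gamma> :: nat
  assumes "a \<ge> c" and "c \<ge> 2"
    and "1 \<le> \<beta>" and "\<beta> \<le> b - 1"
    and "1 \<le> \<gamma>" and "int b - int a + 1 \<le> int \<gamma>"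
    and "\<gamma> \<le> b - 1" and "\<gamma> \<le> c - 1"
    and "a = 4 \<or> b = 4 \<or> c = 4"
  shows "has_WLP (ideal_gen
           {X ^ a :: 'k::field_char_0 poly3,
            Y ^ b - X ^ (b - \<gamma>) * Z ^ \<gamma>,
            Z ^ c,
            X ^ (a + \<gamma> - b) * Y ^ (b - \<beta>),
            Y ^ (b - \<beta>) * Z ^ (c - \<gamma>)})"
proof -
  \<comment> \<open>The integer bound on \<gamma> gives b < a + \<gamma>, so the natural-number
    exponent of x is not truncated.\<close>
  interpret pfaffian_ideal a b c "b - \<beta>" \<gamma> "a + \<gamma> - b" "c - \<gamma>"
    by unfold_locales (use assms in linarith)+
  show ?thesis using has_WLP_I[where 'k = 'k] unfolding gens_def .
qed

end
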